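(* Let $n\ge 3$ be an integer, let $r,s,l$ be nonnegative integers and let $m$ be a positive integer. Assume that all denominators occurring below are nonzero and that all series in the identity under consideration converge. If $m$ is odd, then $$\sum_{k=1}^\infty \frac{1}{w_{mk+s}\,w_{m(k+1)+s}\prod_{j=0}^{n-3}w_{r(k+j)+l}} = \frac{1}{u_m w_{m+s}}\sum_{k=1}^\infty (-1)^{k-1} \frac{\bigl(w_{rk+l}+w_{r(k+n-2)+l}\bigr)u_{mk}}{w_{m(k+1)+s}\prod_{j=0}^{n-2} w_{r(k+j)+l}}.$$ If $m$ is even, then $$\sum_{k=1}^\infty \frac{(-1)^k}{w_{mk+s}\,w_{m(k+1)+s}\prod_{j=0}^{n-3}w_{r(k+j)+l}} = \frac{1}{u_m w_{m+s}}\sum_{k=1}^\infty (-1)^{k} \frac{\bigl(w_{rk+l}+w_{r(k+n-2)+l}\bigr)u_{mk}}{w_{m(k+1)+s}\prod_{j=0}^{n-2} w_{r(k+j)+l}}.$$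
   Context: Let $a,b,p$ be complex numbers. The sequence $(w_n)_{n\ge 0}$ is defined by $w_0=a$, $w_1=b$, $w_n=p\,w_{n-1}+w_{n-2}$ for $n\ge 2$. The sequence $(u_n)_{n\ge0}$ is defined by $u_0=0$, $u_1=1$, $u_n=p\,u_{n-1}+u_{n-2}$ for $n\ge 2$. *)

theory Defs
  imports Complex_Main
begin

fun w_seq :: "complex \<Rightarrow> complex \<Rightarrow> complex \<Rightarrow> nat \<Rightarrow> complex" where
  "w_seq a b p 0 = a"
| "w_seq a b p (Suc 0) = b"
| "w_seq a b p (Suc (Suc n)) = p * w_seq a b p (Suc n) + w_seq a b p n"

definition u_seq :: "complex \<Rightarrow> nat \<Rightarrow> complex" where
  "u_seq p = w_seq 0 1 p"

text \<open>Series indexed from 1: convergence of the partial sums (not necessarily absolute),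
  and the value of the series. The value \<open>f 0\<close> is irrelevant.\<close>

abbreviation summable_from_1 :: "(nat \<Rightarrow> complex) \<Rightarrow> bool" where
  "summable_from_1 f \<equiv> summable (\<lambda>k. f (Suc k))"

abbreviation suminf_from_1 :: "(nat \<Rightarrow> complex) \<Rightarrow> complex" where
  "suminf_from_1 f \<equiv> (\<Sum>k. f (Suc k))"

end

theory Submission
  imports Defs
begin

text \<open>
  The identity is a summation by parts. Put \<open>A\<^sub>k = u\<^bsub>mk\<^esub> / w\<^bsub>m(k+1)+s\<^esub>\<close>, let \<open>P\<^sub>k\<close> be the product of
  the \<open>w\<^bsub>r(k+j)+l\<^esub>\<close> for \<open>0 \<le> j \<le> n - 3\<close>, and put \<open>c = u\<^sub>m w\<^bsub>m+s\<^esub>\<close>. A d'Ocagne type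
  addition formula (\<open>dOcagne\<close>) shows that \<open>A\<^sub>k - A\<^bsub>k-1\<^esub>\<close> is
  \<open>(-1)\<^bsup>m(k-1)\<^esup> c / (w\<^bsub>mk+s\<^esub> w\<^bsub>m(k+1)+s\<^esub>)\<close>, so with a suitable alternating sign \<open>\<sigma>\<^sub>k\<close> the left-hand
  terms, multiplied by \<open>c\<close>, are \<open>\<sigma>\<^sub>k (A\<^sub>k - A\<^bsub>k-1\<^esub>) / P\<^sub>k\<close>. On the other side
  \<open>1 / P\<^sub>k + 1 / P\<^bsub>k+1\<^esub>\<close> has the numerator \<open>w\<^bsub>rk+l\<^esub> + w\<^bsub>r(k+n-2)+l\<^esub>\<close>
  (\<open>window_prod_reciprocals\<close>), so the right-hand terms are
  \<open>\<sigma>\<^sub>k A\<^sub>k (1 / P\<^sub>k + 1 / P\<^bsub>k+1\<^esub>)\<close>. Since \<open>\<sigma>\<close> alternates, the difference of the two telescopes, and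
  because \<open>A\<^sub>0 = 0\<close> its partial sums are the boundary terms \<open>\<sigma>\<^sub>K A\<^sub>K / P\<^bsub>K+1\<^esub>\<close>.

  It remains to see that the boundary terms tend to \<open>0\<close>. For \<open>r = 0\<close> the product is constant, and
  the boundary terms are half the terms of the convergent right-hand series. For \<open>r > 0\<close> the
  closed form of \<open>w\<close> gives a dichotomy (\<open>bounded_or_dominates_fundamental\<close>). If \<open>w\<close> is bounded,
  then the left-hand terms are bounded away from \<open>0\<close>, and the left-hand series diverges. Otherwise
  \<open>w\<close> tends to infinity and grows at least as fast as \<open>u\<close>; then \<open>A\<close> is bounded and \<open>1 / P\<close> tends
  to \<open>0\<close>.
\<close>

section \<open>Addition formulas\<close>

lemma u_seq_simps [simp]:
  "u_seq p 0 = 0" "u_seq p (Suc 0) = 1"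
  "u_seq p (Suc (Suc n)) = p * u_seq p (Suc n) + u_seq p n"
  by (simp_all add: u_seq_def)

text \<open>The left-hand side is a Casorati determinant: each step multiplies it by the determinant
  \<open>-1\<close> of the companion matrix of the recurrence.\<close>

lemma dOcagne_step:
  "u_seq p (Suc i) * w_seq a b p (i + y) - u_seq p i * w_seq a b p (Suc (i + y))
     = (-1) ^ i * w_seq a b p y"
proof (induction i)
  case (Suc i)
  have "u_seq p (Suc (Suc i)) * w_seq a b p (Suc i + y) - u_seq p (Suc i) * w_seq a b p (Suc (Suc i + y))
      = - (u_seq p (Suc i) * w_seq a b p (i + y) - u_seq p i * w_seq a b p (Suc (i + y)))"
    by (simp add: algebra_simps)
  with Suc show ?case by simp
qed simp

text \<open>For fixed \<open>i\<close> and \<open>y\<close> both sides solve the recurrence in \<open>x\<close>, so the cases \<open>x = 0\<close> and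
  \<open>x = 1\<close> suffice.\<close>

lemma dOcagne:
  "u_seq p (i + x) * w_seq a b p (i + y) - u_seq p i * w_seq a b p (i + x + y)
     = (-1) ^ i * (u_seq p x * w_seq a b p y)"
proof (induction x rule: induct_nat_012)
  case 1
  show ?case using dOcagne_step[of p i a b y] by simp
next
  case (ge2 x)
  have "u_seq p (i + Suc (Suc x)) * w_seq a b p (i + y) - u_seq p i * w_seq a b p (i + Suc (Suc x) + y)
      = p * (u_seq p (i + Suc x) * w_seq a b p (i + y) - u_seq p i * w_seq a b p (i + Suc x + y))
        + (u_seq p (i + x) * w_seq a b p (i + y) - u_seq p i * w_seq a b p (i + x + y))"
    by (simp add: algebra_simps)
  also have "\<dots> = (-1) ^ i * (u_seq p (Suc (Suc x)) * w_seq a b p y)"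
    unfolding ge2.IH by (simp add: algebra_simps)
  finally show ?case .
qed simp

section \<open>Growth of the solutions\<close>

lemma binet:
  assumes "\<alpha> * \<beta> = -1" "\<alpha> + \<beta> = p"
  shows "(\<alpha> - \<beta>) * w_seq a b p n = (b - \<beta> * a) * \<alpha> ^ n - (b - \<alpha> * a) * \<beta> ^ n"
proof (induction n rule: induct_nat_012)
  case (ge2 n)
  have root: "\<alpha> * \<alpha> = p * \<alpha> + 1" "\<beta> * \<beta> = p * \<beta> + 1"
    using assms by (auto simp: algebra_simps)
  have "(\<alpha> - \<beta>) * w_seq a b p (Suc (Suc n))
      = p * ((\<alpha> - \<beta>) * w_seq a b p (Suc n)) + (\<alpha> - \<beta>) * w_seq a b p n"
    by (simp add: algebra_simps)
  also have "\<dots> = (b - \<beta> * a) * ((p * \<alpha> + 1) * \<alpha> ^ n) - (b - \<alpha> * a) * ((p * \<beta> + 1) * \<beta> ^ n)"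
    unfolding ge2.IH by (simp add: algebra_simps)
  also have "\<dots> = (b - \<beta> * a) * (\<alpha> * \<alpha> * \<alpha> ^ n) - (b - \<alpha> * a) * (\<beta> * \<beta> * \<beta> ^ n)"
    by (simp only: root)
  finally show ?case by (simp add: mult.assoc)
qed (simp_all add: algebra_simps)

lemma binet_double_root:
  assumes "\<alpha> * \<alpha> = -1" "2 * \<alpha> = p"
  shows "\<alpha> * w_seq a b p n = \<alpha> ^ n * (\<alpha> * a + of_nat n * (b - \<alpha> * a))"
proof (induction n rule: induct_nat_012)
  case (ge2 n)
  have "\<alpha> * w_seq a b p (Suc (Suc n)) = p * (\<alpha> * w_seq a b p (Suc n)) + \<alpha> * w_seq a b p n"
    by (simp add: algebra_simps)
  also have "\<dots> = \<alpha> ^ n * (2 * (\<alpha> * \<alpha>) * (\<alpha> * a + of_nat (Suc n) * (b - \<alpha> * a))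
      + (\<alpha> * a + of_nat n * (b - \<alpha> * a)))"
    unfolding ge2.IH by (simp add: algebra_simps flip: assms(2))
  also have "\<dots> = \<alpha> ^ n * (\<alpha> * \<alpha>) * (\<alpha> * a + of_nat (Suc (Suc n)) * (b - \<alpha> * a))"
    by (simp add: assms(1) algebra_simps)
  finally show ?case by (simp add: mult_ac)
qed (simp_all add: algebra_simps)

lemma characteristic_roots:
  obtains \<alpha> \<beta> :: complex
  where "\<alpha> * \<beta> = -1" "\<alpha> + \<beta> = p" "norm \<alpha> \<ge> 1" "norm \<beta> \<le> 1" "norm \<alpha> * norm \<beta> = 1"
proof -
  define d where "d = csqrt (p\<^sup>2 + 4)"
  have d: "d * d = p * p + 4"
    by (metis d_def power2_csqrt power2_eq_square)
  define x y where "x = (p + d) / 2" and "y = (p - d) / 2"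
  have prod: "x * y = -1" and sum: "x + y = p"
    using d by (simp_all add: x_def y_def algebra_simps flip: add_divide_distrib)
  have norms: "norm x * norm y = 1"
    using prod by (metis norm_minus_cancel norm_mult norm_one)
  show thesis
  proof (cases "norm x \<ge> 1")
    case True
    hence "norm y \<le> 1"
      using norms mult_right_mono[OF True, of "norm y"] by simp
    with True prod sum norms that[of x y] show ?thesis by blast
  next
    case False
    hence "norm y \<ge> 1"
      using norms mult_right_mono[of "norm x" 1 "norm y"] by simp
    with False prod sum norms that[of y x] show ?thesis by (simp add: mult.commute add.commute)
  qed
qed

text \<open>By \<open>binet\<close> the solution is \<open>D \<alpha>\<^sup>n - F \<beta>\<^sup>n\<close> up to a nonzero factor, where
  \<open>norm \<beta> \<le> 1 \<le> norm \<alpha>\<close>. It is bounded if \<open>D = 0\<close> or both roots lie on the unit circle;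
  otherwise it grows like \<open>norm \<alpha> ^ n\<close>, which no solution can outgrow. A double root
  lies on the unit circle, and then an unbounded solution grows like \<open>n\<close>.\<close>

lemma bounded_or_dominant_growth:
  shows "(\<exists>C. \<forall>n. norm (w_seq a b p n) \<le> C) \<or>
    (\<exists>g c C E. mono g \<and> filterlim g at_top sequentially \<and> c > 0 \<and>
       (\<forall>n. norm (u_seq p n) \<le> C * g n) \<and> (\<forall>n. norm (w_seq a b p n) \<ge> c * g n - E))"
    (is "?bounded \<or> ?dominant")
proof -
  obtain \<alpha> \<beta> where ab: "\<alpha> * \<beta> = -1" "\<alpha> + \<beta> = p" "norm \<alpha> \<ge> 1" "norm \<beta> \<le> 1"
      "norm \<alpha> * norm \<beta> = 1"
    by (rule characteristic_roots)
  define D where "D = b - \<beta> * a"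
  define F where "F = b - \<alpha> * a"
  have \<beta>_pow: "norm \<beta> ^ n \<le> 1" for n
    using ab(4) by (simp add: power_le_one)
  show ?thesis
  proof (cases "\<alpha> = \<beta>")
    case False
    define e where "e = norm (\<alpha> - \<beta>)"
    have e: "e > 0" using False by (simp add: e_def)
    have w: "e * norm (w_seq a b p n) = norm (D * \<alpha> ^ n - F * \<beta> ^ n)" for n
      using binet[OF ab(1,2), of a b n] by (metis D_def F_def e_def norm_mult)
    have F: "norm (F * \<beta> ^ n) \<le> norm F" for n
      using \<beta>_pow by (simp add: norm_mult norm_power mult_left_le)
    show ?thesis
    proof (cases "D = 0 \<or> norm \<alpha> = 1")
      case True
      have "norm (D * \<alpha> ^ n) \<le> norm D" for n
        using True by (auto simp: norm_mult norm_power)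
      hence "e * norm (w_seq a b p n) \<le> norm D + norm F" for n
        using w[of n] F[of n] norm_triangle_ineq4[of "D * \<alpha> ^ n" "F * \<beta> ^ n"]
        by (smt (verit))
      hence "norm (w_seq a b p n) \<le> (norm D + norm F) / e" for n
        using e by (simp add: field_simps)
      thus ?thesis by blast
    next
      case False
      hence \<alpha>: "norm \<alpha> > 1" using ab(3) by auto
      have "mono (\<lambda>n. norm \<alpha> ^ n)"
        using ab(3) by (simp add: mono_def power_increasing)
      moreover have "filterlim (\<lambda>n. norm \<alpha> ^ n) at_top sequentially"
        using filterlim_at_infinity_imp_norm_at_top[OF filterlim_realpow_sequentially_gt1[OF \<alpha>]]
        by (simp add: norm_power)
      moreover have "norm D / e > 0" using False e by simp
      moreover have "norm (u_seq p n) \<le> (2 / e) * norm \<alpha> ^ n" for n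
      proof -
        have "e * norm (u_seq p n) = norm (\<alpha> ^ n - \<beta> ^ n)"
          using binet[OF ab(1,2), of 0 1 n]
          by (metis (no_types) e_def norm_mult u_seq_def mult_zero_right diff_zero mult_1)
        also have "\<dots> \<le> norm \<alpha> ^ n + norm \<beta> ^ n"
          by (metis norm_triangle_ineq4 norm_power)
        also have "\<dots> \<le> 2 * norm \<alpha> ^ n"
          using \<beta>_pow[of n] one_le_power[OF ab(3), of n] by linarith
        finally show ?thesis using e by (simp add: field_simps)
      qed
      moreover have "norm (w_seq a b p n) \<ge> (norm D / e) * norm \<alpha> ^ n - norm F / e" for n
      proof -
        have "norm D * norm \<alpha> ^ n - norm F \<le> e * norm (w_seq a b p n)"
          using w[of n] F[of n] norm_triangle_ineq2[of "D * \<alpha> ^ n" "F * \<beta> ^ n"]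
          by (simp add: norm_mult norm_power)
        thus ?thesis using e by (simp add: field_simps)
      qed
      ultimately show ?thesis by blast
    qed
  next
    case True
    have root: "\<alpha> * \<alpha> = -1" "2 * \<alpha> = p" using ab True by simp_all
    have \<alpha>: "norm \<alpha> = 1" using ab True by simp
    have w: "norm (w_seq a' b' p n) = norm (\<alpha> * a' + of_nat n * (b' - \<alpha> * a'))" for n a' b'
    proof -
      have "norm (\<alpha> * w_seq a' b' p n) = norm (\<alpha> ^ n * (\<alpha> * a' + of_nat n * (b' - \<alpha> * a')))"
        by (simp only: binet_double_root[OF root])
      thus ?thesis by (simp add: norm_mult norm_power \<alpha>)
    qed
    show ?thesis
    proof (cases "D = 0")
      case D: True
      hence "norm (w_seq a b p n) \<le> norm (\<alpha> * a)" for n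
        using w[of a b n] True by (simp add: D_def)
      thus ?thesis by blast
    next
      case False
      have "mono real" by (simp add: mono_def)
      moreover have "filterlim real at_top sequentially"
        by (rule filterlim_real_sequentially)
      moreover have "norm D > 0" using False by simp
      moreover have "norm (u_seq p n) \<le> 1 * real n" for n
        using w[of 0 1 n] by (simp add: u_seq_def)
      moreover have "norm (w_seq a b p n) \<ge> norm D * real n - norm (\<alpha> * a)" for n
        using norm_diff_ineq[of "of_nat n * D" "\<alpha> * a"] w[of a b n] True
        by (simp add: D_def norm_mult add.commute mult.commute)
      ultimately show ?thesis by blast
    qed
  qed
qed

text \<open>The form in which the dichotomy is needed. The shift \<open>d\<close> is harmless because the
  growth function above is monotone.\<close>

lemma bounded_or_dominates_fundamental:
  shows "(\<exists>C. \<forall>n. norm (w_seq a b p n) \<le> C) \<or>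
    (filterlim (w_seq a b p) at_infinity sequentially \<and>
     (\<exists>C. \<forall>\<^sub>F n in sequentially. norm (u_seq p n) \<le> C * norm (w_seq a b p (n + d))))"
  using bounded_or_dominant_growth[of a b p]
proof (elim disjE exE conjE)
  fix g :: "nat \<Rightarrow> real" and c C E :: real
  assume g: "mono g" "filterlim g at_top sequentially" and c: "c > 0"
    and u: "\<forall>n. norm (u_seq p n) \<le> C * g n"
    and w: "\<forall>n. c * g n - E \<le> norm (w_seq a b p n)"
  \<comment> \<open>Once \<open>g\<close> is large, the constant \<open>E\<close> costs at most half of the main term.\<close>
  have half: "\<forall>\<^sub>F n in sequentially. c / 2 * g n \<le> norm (w_seq a b p n) \<and> g n \<ge> 0"
  proof -
    have "\<forall>\<^sub>F n in sequentially. g n \<ge> max 0 (2 * E / c)"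
      using g(2) unfolding filterlim_at_top by blast
    thus ?thesis
    proof eventually_elim
      case (elim n)
      hence "E \<le> c / 2 * g n" using c by (simp add: field_simps)
      with w[rule_format, of n] elim show ?case by (simp add: field_simps)
    qed
  qed
  have "filterlim (\<lambda>n. c / 2 * g n) at_top sequentially"
    using c g(2) by (intro filterlim_tendsto_pos_mult_at_top[OF tendsto_const]) auto
  hence "filterlim (\<lambda>n. norm (w_seq a b p n)) at_top sequentially"
    by (rule filterlim_at_top_mono) (use half in \<open>auto elim: eventually_mono\<close>)
  hence "filterlim (w_seq a b p) at_infinity sequentially"
    by (rule filterlim_norm_at_top_imp_at_infinity)
  moreover have "\<forall>\<^sub>F n in sequentially.
      norm (u_seq p n) \<le> (2 * \<bar>C\<bar> / c) * norm (w_seq a b p (n + d))"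
  proof -
    have "\<forall>\<^sub>F n in sequentially. c / 2 * g (n + d) \<le> norm (w_seq a b p (n + d)) \<and> g (n + d) \<ge> 0"
      using half by (subst eventually_sequentially_seg)
    thus ?thesis
      using half
    proof eventually_elim
      case (elim n)
      have "norm (u_seq p n) \<le> C * g n" using u by simp
      also have "\<dots> \<le> \<bar>C\<bar> * g (n + d)"
        using elim g(1) by (intro mult_mono) (auto simp: mono_def)
      also have "\<dots> = (2 * \<bar>C\<bar> / c) * (c / 2 * g (n + d))" using c by simp
      also have "\<dots> \<le> (2 * \<bar>C\<bar> / c) * norm (w_seq a b p (n + d))"
        using elim c by (intro mult_left_mono) auto
      finally show ?case .
    qed
  qed
  ultimately show ?thesis by blast
qed blast

section \<open>Summation by parts\<close>

lemma mult_add_at_top: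
  assumes "(r::nat) > 0"
  shows "filterlim (\<lambda>k. r * (k + j) + l) sequentially sequentially"
  using assms by (intro filterlim_subseq) (simp add: strict_mono_def)

lemma window_prod_inverse_tendsto_0:
  fixes f :: "nat \<Rightarrow> 'a :: real_normed_field"
  assumes "filterlim f at_infinity sequentially" "r > 0"
  shows "(\<lambda>k. inverse (\<Prod>j=0..q. f (r * (k + j) + l))) \<longlonglongrightarrow> 0"
proof -
  have "(\<lambda>k. inverse (f (r * (k + j) + l))) \<longlonglongrightarrow> 0" for j
    using filterlim_compose[OF assms(1) mult_add_at_top[OF assms(2)]]
    by (rule filterlim_compose[OF tendsto_inverse_0])
  hence "(\<lambda>k. \<Prod>j=0..q. inverse (f (r * (k + j) + l))) \<longlonglongrightarrow> (\<Prod>j=0..q. 0)"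
    by (intro tendsto_prod)
  thus ?thesis by (simp add: prod_inversef[symmetric] o_def)
qed

text \<open>Both products omit one end factor of the longer product: the last one and the first one.\<close>

lemma window_prod_reciprocals:
  fixes f :: "nat \<Rightarrow> 'a :: field"
  assumes "(\<Prod>j=0..Suc q. f (r * (k + j) + l)) \<noteq> 0"
  shows "1 / (\<Prod>j=0..q. f (r * (k + j) + l)) + 1 / (\<Prod>j=0..q. f (r * (Suc k + j) + l))
       = (f (r * k + l) + f (r * (k + Suc q) + l)) / (\<Prod>j=0..Suc q. f (r * (k + j) + l))"
proof -
  have last: "(\<Prod>j=0..Suc q. f (r * (k + j) + l))
      = (\<Prod>j=0..q. f (r * (k + j) + l)) * f (r * (k + Suc q) + l)"
    by (simp add: prod.atLeast0_atMost_Suc)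
  have first: "(\<Prod>j=0..Suc q. f (r * (k + j) + l))
      = f (r * k + l) * (\<Prod>j=0..q. f (r * (Suc k + j) + l))"
    by (subst prod.atLeast0_atMost_Suc_shift) (simp add: o_def)
  let ?Q = "\<Prod>j=0..Suc q. f (r * (k + j) + l)"
  have "1 / (\<Prod>j=0..q. f (r * (k + j) + l)) = f (r * (k + Suc q) + l) / ?Q"
    using assms unfolding last by simp
  moreover have "1 / (\<Prod>j=0..q. f (r * (Suc k + j) + l)) = f (r * k + l) / ?Q"
    using assms unfolding first by simp
  ultimately show ?thesis by (simp add: add_divide_distrib)
qed

text \<open>The summands are indexed from \<open>0\<close>. The parity of \<open>m\<close> enters only through the factor
  \<open>(-1) ^ (m * k)\<close> from \<open>dOcagne\<close>: it cancels \<open>\<sigma> k\<close> up to a constant for odd \<open>m\<close> and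
  disappears for even \<open>m\<close>. The two halves of the identity are therefore the cases
  \<open>\<sigma> k = (-1) ^ k\<close> and \<open>\<sigma> k = (-1) ^ Suc k\<close> of this one.\<close>

lemma alternating_reciprocal_series:
  fixes a b p :: complex and \<sigma> :: "nat \<Rightarrow> complex" and m r s l q :: nat
  defines "w \<equiv> w_seq a b p" and "u \<equiv> u_seq p"
  defines "P \<equiv> \<lambda>k. \<Prod>j=0..q. w (r * (k + j) + l)"
  defines "Q \<equiv> \<lambda>k. \<Prod>j=0..Suc q. w (r * (k + j) + l)"
  defines "L \<equiv> \<lambda>k. \<sigma> k * (-1) ^ (m * k) / (w (m * Suc k + s) * w (m * Suc (Suc k) + s) * P (Suc k))"
  defines "R \<equiv> \<lambda>k. \<sigma> k * ((w (r * Suc k + l) + w (r * (Suc k + Suc q) + l)) * u (m * Suc k) /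
                  (w (m * Suc (Suc k) + s) * Q (Suc k)))"
  assumes m: "m > 0"
    and w_nz: "\<And>k. w (m * Suc k + s) \<noteq> 0"
    and Q_nz: "\<And>k. Q (Suc k) \<noteq> 0"
    and u_nz: "u m \<noteq> 0"
    and \<sigma>_Suc: "\<And>k. \<sigma> (Suc k) = - \<sigma> k" and \<sigma>_norm: "\<And>k. norm (\<sigma> k) = 1"
    and L: "summable L" and R: "summable R"
  shows "suminf L = 1 / (u m * w (m + s)) * suminf R"
proof -
  define A where "A = (\<lambda>k. u (m * k) / w (m * Suc k + s))"
  define T where "T = (\<lambda>k. - \<sigma> k * A k / P (Suc k))"
  define c where "c = u m * w (m + s)"
  have c: "c \<noteq> 0" using u_nz w_nz[of 0] by (simp add: c_def)
  have P_nz: "P (Suc k) \<noteq> 0" for k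
    using Q_nz[of k] by (simp add: P_def Q_def)
  have R_eq: "R k = \<sigma> k * A (Suc k) * (1 / P (Suc k) + 1 / P (Suc (Suc k)))" for k
  proof -
    have "1 / P (Suc k) + 1 / P (Suc (Suc k))
        = (w (r * Suc k + l) + w (r * (Suc k + Suc q) + l)) / Q (Suc k)"
      using Q_nz[of k] unfolding P_def Q_def by (rule window_prod_reciprocals)
    thus ?thesis by (simp add: R_def A_def)
  qed
  have diff_A: "(-1) ^ (m * k) * c / (w (m * Suc k + s) * w (m * Suc (Suc k) + s)) = A (Suc k) - A k"
    for k
  proof -
    have "u (m * Suc k) * w (m * Suc k + s) - u (m * k) * w (m * Suc (Suc k) + s) = (-1) ^ (m * k) * c"
      using dOcagne[of p "m * k" m a b "m + s"] by (simp add: c_def u_def w_def algebra_simps)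
    thus ?thesis
      using w_nz[of k] w_nz[of "Suc k"] by (simp add: A_def divide_simps)
  qed
  have L_eq: "c * L k = \<sigma> k * (A (Suc k) - A k) / P (Suc k)" for k
    unfolding diff_A[symmetric] L_def by simp
  have "R k - c * L k = T (Suc k) - T k" for k
    unfolding R_eq L_eq by (simp add: T_def \<sigma>_Suc algebra_simps diff_divide_distrib)
  moreover have "T 0 = 0"
    by (simp add: T_def A_def u_def)
  ultimately have partial: "(\<Sum>k<K. R k - c * L k) = T K" for K
    by (simp add: sum_lessThan_telescope)

  \<comment> \<open>The partial sums reduce the claim to the vanishing of the boundary term. Convergence of both
    series alone yields only that \<open>T\<close> has some limit.\<close>
  have T_0: "T \<longlonglongrightarrow> 0"
  proof (cases "r = 0")
    case True
    \<comment> \<open>The product \<open>P\<close> is constant, so the terms of the convergent series \<open>R\<close> control \<open>T\<close>.\<close>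
    have "R k = 2 * T (Suc k)" for k
      by (simp add: R_eq T_def \<sigma>_Suc P_def True)
    hence "(\<lambda>k. T (Suc k)) = (\<lambda>k. R k / 2)" by simp
    also have "\<dots> \<longlonglongrightarrow> 0"
      using tendsto_divide[OF summable_LIMSEQ_zero[OF R] tendsto_const[of 2]] by simp
    finally show ?thesis by (rule LIMSEQ_imp_Suc)
  next
    case False
    from bounded_or_dominates_fundamental[of a b p "m + s"] show ?thesis
    proof (elim disjE exE conjE)
      fix C assume C: "\<forall>n. norm (w_seq a b p n) \<le> C"
      have C': "norm (w i) \<le> C" for i using C by (simp add: w_def)
      have C0: "C > 0" using C'[of "m * Suc 0 + s"] w_nz[of 0] by (smt (verit) zero_less_norm_iff)
      \<comment> \<open>Bounded denominators keep the terms of the convergent series \<open>L\<close> away from \<open>0\<close>.\<close>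
      have "1 / (C * C * C ^ Suc q) \<le> norm (L k)" for k
      proof -
        have "norm (P (Suc k)) \<le> C ^ Suc q"
          unfolding P_def prod_norm[symmetric]
          using prod_mono[of "{0..q}" "\<lambda>j. norm (w (r * (Suc k + j) + l))" "\<lambda>_. C"] C' by simp
        hence "norm (w (m * Suc k + s) * w (m * Suc (Suc k) + s) * P (Suc k)) \<le> C * C * C ^ Suc q"
          unfolding norm_mult using C0 C' by (intro mult_mono) auto
        moreover have "norm (w (m * Suc k + s) * w (m * Suc (Suc k) + s) * P (Suc k)) > 0"
          using w_nz[of k] w_nz[of "Suc k"] P_nz[of k] by simp
        ultimately show ?thesis
          unfolding L_def norm_divide norm_mult[of "\<sigma> k"] \<sigma>_norm
          by (simp add: norm_power frac_le del: mult_Suc_right power_Suc)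
      qed
      moreover have "(\<lambda>k. norm (L k)) \<longlonglongrightarrow> 0"
        using summable_LIMSEQ_zero[OF L] by (rule tendsto_norm_zero)
      ultimately have "1 / (C * C * C ^ Suc q) \<le> 0"
        by (intro LIMSEQ_le_const[where X = "\<lambda>k. norm (L k)"]) auto
      moreover have "1 / (C * C * C ^ Suc q) > 0" using C0 by simp
      ultimately show ?thesis by linarith
    next
      fix C
      assume w_inf: "filterlim (w_seq a b p) at_infinity sequentially"
        and u_le: "\<forall>\<^sub>F n in sequentially. norm (u_seq p n) \<le> C * norm (w_seq a b p (n + (m + s)))"
      \<comment> \<open>Here \<open>A\<close> is bounded, and the factors of \<open>P\<close> tend to infinity because \<open>r > 0\<close>.\<close>
      have "\<forall>\<^sub>F k in sequentially. norm (u (m * k)) \<le> C * norm (w (m * Suc k + s))"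
        using eventually_compose_filterlim[OF u_le mult_add_at_top[OF m, of 0 0]]
        by (simp add: u_def w_def algebra_simps)
      hence "\<forall>\<^sub>F k in sequentially. norm (T k) \<le> norm (inverse (P (Suc k))) * C"
      proof eventually_elim
        case (elim k)
        hence "norm (A k) \<le> C"
          using w_nz[of k] by (simp add: A_def norm_divide divide_simps)
        thus ?case
          by (simp add: T_def norm_divide norm_mult norm_inverse \<sigma>_norm divide_inverse mult.commute mult_right_mono)
      qed
      moreover have "(\<lambda>k. inverse (P (Suc k))) \<longlonglongrightarrow> 0"
        using window_prod_inverse_tendsto_0[OF w_inf, of r l q] False
        unfolding P_def w_def by (intro LIMSEQ_Suc) simp
      ultimately show ?thesis by (rule tendsto_0_le[rotated])
    qed
  qed

  have "(\<lambda>k. R k - c * L k) sums (suminf R - c * suminf L)"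
    using L R by (intro sums_diff sums_mult summable_sums)
  moreover have "(\<lambda>k. R k - c * L k) sums 0"
    using T_0 by (simp add: sums_def partial)
  ultimately have "suminf R = c * suminf L"
    using sums_unique2 by fastforce
  thus ?thesis using c by (simp flip: c_def)
qed

theorem theorem9:
  fixes a b p :: complex
    and w u :: "nat \<Rightarrow> complex"
    and n r s l m :: nat
  assumes w: "w = w_seq a b p"
    and u: "u = u_seq p"
    and n: "n \<ge> 3"
    and m: "m > 0"
    and den_lhs: "\<And>k. k \<ge> 1 \<Longrightarrow>
          w (m * k + s) * w (m * (k + 1) + s) * (\<Prod>j=0..n-3. w (r * (k + j) + l)) \<noteq> 0"
    and den_factor: "u m * w (m + s) \<noteq> 0"
    and den_rhs: "\<And>k. k \<ge> 1 \<Longrightarrow>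
          w (m * (k + 1) + s) * (\<Prod>j=0..n-2. w (r * (k + j) + l)) \<noteq> 0"
  shows "(odd m \<longrightarrow>
          (let L = (\<lambda>k. 1 /
                 (w (m * k + s) * w (m * (k + 1) + s) * (\<Prod>j=0..n-3. w (r * (k + j) + l))));
               R = (\<lambda>k. (-1) ^ (k - 1) *
                 ((w (r * k + l) + w (r * (k + n - 2) + l)) * u (m * k) /
                  (w (m * (k + 1) + s) * (\<Prod>j=0..n-2. w (r * (k + j) + l)))))
           in summable_from_1 L \<longrightarrow> summable_from_1 R \<longrightarrow>
              suminf_from_1 L = 1 / (u m * w (m + s)) * suminf_from_1 R))
      \<and> (even m \<longrightarrow>
          (let L = (\<lambda>k. (-1) ^ k /
                 (w (m * k + s) * w (m * (k + 1) + s) * (\<Prod>j=0..n-3. w (r * (k + j) + l))));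
               R = (\<lambda>k. (-1) ^ k *
                 ((w (r * k + l) + w (r * (k + n - 2) + l)) * u (m * k) /
                  (w (m * (k + 1) + s) * (\<Prod>j=0..n-2. w (r * (k + j) + l)))))
           in summable_from_1 L \<longrightarrow> summable_from_1 R \<longrightarrow>
              suminf_from_1 L = 1 / (u m * w (m + s)) * suminf_from_1 R))"
proof -
  obtain q where q: "n = q + 3" using n by (metis add.commute le_iff_add)
  have idx: "n - 3 = q" "n - 2 = Suc q" "k + n - 2 = k + Suc q" for k using q by auto
  have w_nz: "w_seq a b p (m * Suc k + s) \<noteq> 0" for k
    using den_lhs[of "Suc k"] w by simp
  have Q_nz: "(\<Prod>j=0..Suc q. w_seq a b p (r * (Suc k + j) + l)) \<noteq> 0" for k
    using den_rhs[of "Suc k"] unfolding idx w by simp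
  have u_nz: "u_seq p m \<noteq> 0" using den_factor u by simp
  note series = alternating_reciprocal_series[OF m w_nz Q_nz u_nz]
  show ?thesis
  proof (cases "odd m")
    case True
    hence sign: "(-1) ^ k * (-1) ^ (m * k) = (1::complex)" for k
      by (simp add: power_mult flip: power_mult_distrib)
    show ?thesis
      using series[of "\<lambda>k. (-1) ^ k"] True
      unfolding Let_def sign idx w u by (simp add: norm_power)
  next
    case False
    hence sign: "(-1) ^ (m * k) = (1::complex)" for k by simp
    show ?thesis
      using series[of "\<lambda>k. (-1) ^ Suc k"] False
      unfolding Let_def sign idx w u by (simp add: norm_power)
  qed
qed

end
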